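(* Let $O$ be an occurrence p-net with its initial state, let $\sigma=t_1;\cdots;t_n$ ($n\ge0$) be a (possibly empty) non-stuttering firing sequence of $O$ from its initial state, and let $t$ be a transition of $O$ not occurring in $\sigma$. The following are equivalent: (i) $t$ is enabled after $\sigma$; (ii) some collection of causes of $t$ is contained in $\{t_1,\dots,t_n\}$; (iii) the propositional formula $\bigwedge_{i=1}^n t_i$ implies $\Phi(t)$.
   Context: A p-net is $(P\uplus\mathbf{P},T,F)$ with regular places $P$, persistent places $\mathbf{P}$, transitions $T$, flow $F\subseteq((P\cup\mathbf{P})\times T)\cup(T\times(P\cup\mathbf{P}))$; ${}^\bullet x=\{y\mid(y,x)\in F\}$, $x^\bullet=\{z\mid(x,z)\in F\}$; transitions have nonempty presets. States are bags $b:P\cup\mathbf{P}\to\mathbb{N}\cup\{\infty\}$ with $b(p)\in\mathbb{N}$ on regular and $b(\mathbf{p})\in\{0,\infty\}$ on persistent places. $t$ is enabled at $b$ iff $b(s)\ge1$ for all $s\in{}^\bullet t$; firing yields $b'$ with $b'(s)=b(s)-[s\in{}^\bullet t]+[s\in t^\bullet]$ on regular places and $b'(\mathbf{p})=\infty$ if $\mathbf{p}\in t^\bullet$ or $b(\mathbf{p})=\infty$, else $0$, on persistent places. A firing sequence is non-stuttering if no transition occurs more than once. An occurrence p-net is an acyclic p-net with $|{}^\bullet p|\le1$ and $|p^\bullet|\le1$ for every regular place $p$ (persistent places may have several input and output transitions). Its initial state marks each regular place with empty preset with $1$ token and each persistent place with empty preset with $\infty$, and all other places with $0$. Causes: treat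 transitions as propositional variables and define by well-founded recursion $\Phi(x)=\mathit{true}$ for a place $x$ with ${}^\bullet x=\emptyset$; $\Phi(x)=\bigvee_{u\in{}^\bullet x}(u\wedge\Phi(u))$ for a place with nonempty preset; $\Phi(x)=\bigwedge_{s\in{}^\bullet x}\Phi(s)$ for a transition $x$. $\Phi(x)$ is a monotone (negation-free) formula; its unique disjunctive normal form consisting of its prime implicants is a set of sets of transitions, called the collections of causes of $x$ (the empty collection corresponding to $\mathit{true}$). *)

theory Defs
  imports "HOL-Library.Extended_Nat" "HOL-Library.FuncSet"
begin

record 'a net =
  reg :: "'a set"  \<comment> \<open>regular places\<close>
  per :: "'a set"  \<comment> \<open>persistent places\<close>
  trn :: "'a set"  \<comment> \<open>transitions\<close>
  flow :: "('a \<times> 'a) set"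

definition preset :: "'a net \<Rightarrow> 'a \<Rightarrow> 'a set" where
  "preset N x = {y. (y, x) \<in> flow N}"

definition postset :: "'a net \<Rightarrow> 'a \<Rightarrow> 'a set" where
  "postset N x = {z. (x, z) \<in> flow N}"

definition p_net :: "'a net \<Rightarrow> bool" where
  "p_net N \<longleftrightarrow>
     reg N \<inter> per N = {} \<and> (reg N \<union> per N) \<inter> trn N = {} \<and>
     flow N \<subseteq> ((reg N \<union> per N) \<times> trn N) \<union> (trn N \<times> (reg N \<union> per N)) \<and>
     (\<forall>t\<in>trn N. preset N t \<noteq> {})"

text \<open>A bag on the places is a function on the whole node type that is 0 outside the places.\<close>

definition is_state :: "'a net \<Rightarrow> ('a \<Rightarrow> enat) \<Rightarrow> bool" where
  "is_state N b \<longleftrightarrow>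
     (\<forall>p\<in>reg N. b p \<noteq> \<infinity>) \<and> (\<forall>p\<in>per N. b p \<in> {0, \<infinity>}) \<and>
     (\<forall>x. x \<notin> reg N \<union> per N \<longrightarrow> b x = 0)"

definition enabled :: "'a net \<Rightarrow> ('a \<Rightarrow> enat) \<Rightarrow> 'a \<Rightarrow> bool" where
  "enabled N b t \<longleftrightarrow> t \<in> trn N \<and> (\<forall>s\<in>preset N t. b s \<ge> 1)"

text \<open>The subtraction on \<^typ>\<open>enat\<close> truncates, but \<open>fire\<close> is only used for enabled transitions.\<close>

definition fire :: "'a net \<Rightarrow> ('a \<Rightarrow> enat) \<Rightarrow> 'a \<Rightarrow> ('a \<Rightarrow> enat)" where
  "fire N b t = (\<lambda>s.
     if s \<in> reg N then b s - of_bool (s \<in> preset N t) + of_bool (s \<in> postset N t)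
     else if s \<in> per N then (if s \<in> postset N t \<or> b s = \<infinity> then \<infinity> else 0)
     else 0)"

inductive firing_sequence ::
  "'a net \<Rightarrow> ('a \<Rightarrow> enat) \<Rightarrow> 'a list \<Rightarrow> ('a \<Rightarrow> enat) \<Rightarrow> bool" for N where
  Nil: "firing_sequence N b [] b"
| Cons: "enabled N b t \<Longrightarrow> firing_sequence N (fire N b t) ts b' \<Longrightarrow>
    firing_sequence N b (t # ts) b'"

text \<open>The finiteness conditions are needed because \<open>card\<close> is 0 on infinite sets.\<close>

definition occurrence_p_net :: "'a net \<Rightarrow> bool" where
  "occurrence_p_net N \<longleftrightarrow>
     p_net N \<and> acyclic (flow N) \<and>
     (\<forall>p\<in>reg N. finite (preset N p) \<and> card (preset N p) \<le> 1 \<and>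
                 finite (postset N p) \<and> card (postset N p) \<le> 1)"

definition initial :: "'a net \<Rightarrow> ('a \<Rightarrow> enat)" where
  "initial N = (\<lambda>x.
     if x \<in> reg N \<and> preset N x = {} then 1
     else if x \<in> per N \<and> preset N x = {} then \<infinity>
     else 0)"

lemma is_state_initial: "p_net N \<Longrightarrow> is_state N (initial N)"
  by (auto simp: is_state_def initial_def p_net_def simp del: not_infinity_eq)

lemma is_state_fire:
  assumes "p_net N" "is_state N b"
  shows "is_state N (fire N b t)"
proof -
  have "b p - of_bool A + of_bool B \<noteq> \<infinity>" if "p \<in> reg N" for p A B
  proof -
    from assms(2) that obtain k where "b p = enat k" by (auto simp: is_state_def)
    then show ?thesis by (cases A; cases B) (auto simp: one_enat_def zero_enat_def)
  qed
  then show ?thesis using assms by (auto simp: is_state_def fire_def p_net_def)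
qed

text \<open>
  Negation-free propositional formulas. Presets may be infinite, so conjunctions and
  disjunctions are over arbitrary families, which are indexed by the variables (below:
  by the nodes of the net). Members of a family outside its index set are irrelevant.
\<close>

datatype 'v formula =
    Truth
  | Var 'v
  | And "'v formula" "'v formula"
  | BigAnd "'v set" "'v \<Rightarrow> 'v formula"
  | BigOr "'v set" "'v \<Rightarrow> 'v formula"

primrec sat :: "('v \<Rightarrow> bool) \<Rightarrow> 'v formula \<Rightarrow> bool" where
  "sat v Truth \<longleftrightarrow> True"
| "sat v (Var x) \<longleftrightarrow> v x"
| "sat v (And f g) \<longleftrightarrow> sat v f \<and> sat v g"
| "sat v (BigAnd I f) \<longleftrightarrow> (\<forall>i\<in>I. sat v (f i))"
| "sat v (BigOr I f) \<longleftrightarrow> (\<exists>i\<in>I. sat v (f i))"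

definition entails :: "'v formula \<Rightarrow> 'v formula \<Rightarrow> bool" where
  "entails f g \<longleftrightarrow> (\<forall>v. sat v f \<longrightarrow> sat v g)"

text \<open>
  As formulas are negation-free, only conjunctions of positive literals occur as prime
  implicants; such a conjunction is represented by its set of variables.
\<close>

definition implicant :: "'v formula \<Rightarrow> 'v set \<Rightarrow> bool" where
  "implicant f C \<longleftrightarrow> entails (BigAnd C Var) f"

definition prime_implicant :: "'v formula \<Rightarrow> 'v set \<Rightarrow> bool" where
  "prime_implicant f C \<longleftrightarrow> implicant f C \<and> (\<forall>D. D \<subset> C \<longrightarrow> \<not> implicant f D)"

definition Phi :: "'a net \<Rightarrow> 'a \<Rightarrow> 'a formula" where
  "Phi N = wfrec (flow N) (\<lambda>\<phi> x.
     if x \<in> trn N then BigAnd (preset N x) (\<lambda>s\<in>preset N x. \<phi> s)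
     else if preset N x = {} then Truth
     else BigOr (preset N x) (\<lambda>u\<in>preset N x. And (Var u) (\<phi> u)))"

lemma Phi_unfold:
  assumes "wf (flow N)"
  shows "Phi N x =
     (if x \<in> trn N then BigAnd (preset N x) (\<lambda>s\<in>preset N x. Phi N s)
      else if preset N x = {} then Truth
      else BigOr (preset N x) (\<lambda>u\<in>preset N x. And (Var u) (Phi N u)))"
proof -
  have cut: "restrict (\<lambda>s. h (cut f (flow N) x s) s) (preset N x)
      = restrict (\<lambda>s. h (f s) s) (preset N x)" for f :: "'a \<Rightarrow> 'a formula" and h :: "'a formula \<Rightarrow> 'a \<Rightarrow> 'a formula"
    by (rule restrict_ext) (simp add: preset_def cut_apply)
  show ?thesis
    using cut[of "\<lambda>y _. y" "Phi N"] cut[of "\<lambda>y u. And (Var u) y" "Phi N"]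
    unfolding Phi_def by (subst wfrec[OF assms]) simp
qed

lemma Phi_place_initial:
  "wf (flow N) \<Longrightarrow> x \<notin> trn N \<Longrightarrow> preset N x = {} \<Longrightarrow> Phi N x = Truth"
  by (subst Phi_unfold) auto

lemma Phi_place:
  "wf (flow N) \<Longrightarrow> x \<notin> trn N \<Longrightarrow> preset N x \<noteq> {} \<Longrightarrow>
    Phi N x = BigOr (preset N x) (\<lambda>u\<in>preset N x. And (Var u) (Phi N u))"
  by (subst Phi_unfold) auto

lemma Phi_transition:
  "wf (flow N) \<Longrightarrow> x \<in> trn N \<Longrightarrow>
    Phi N x = BigAnd (preset N x) (\<lambda>s\<in>preset N x. Phi N s)"
  by (subst Phi_unfold) auto

text \<open>The assumption \<^prop>\<open>wf (flow N)\<close> is implied by acyclicity for finite nets.\<close>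

lemma wf_flow_finite:
  assumes "occurrence_p_net N" "finite (reg N)" "finite (per N)" "finite (trn N)"
  shows "wf (flow N)"
proof (rule finite_acyclic_wf)
  show "finite (flow N)"
    by (rule finite_subset[of _ "((reg N \<union> per N) \<times> trn N) \<union> (trn N \<times> (reg N \<union> per N))"])
      (use assms in \<open>auto simp: occurrence_p_net_def p_net_def\<close>)
  show "acyclic (flow N)" using assms(1) by (simp add: occurrence_p_net_def)
qed

definition causes :: "'a net \<Rightarrow> 'a \<Rightarrow> 'a set set" where
  "causes N x = {C. prime_implicant (Phi N x) C}"

end

(* Let S be the set of transitions fired by the sequence; Phi t is monotone, so (iii) says that the
   valuation S satisfies Phi t. If t is enabled, then S satisfies Phi t, because every marked place
   carries a satisfied formula and firing preserves this. Conversely, if S satisfies Phi t, then each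
   precondition of t is initially marked or has a producer in S. Its token is still present: it is
   persistent, or t is its only consumer, and t has not fired. (ii) and (iii) agree because S is
   finite, so any implicant contained in S shrinks to a prime one. *)

theory Submission
  imports Defs
begin

lemma sat_mono: "sat v f \<Longrightarrow> (\<And>x. v x \<Longrightarrow> w x) \<Longrightarrow> sat w f"
  by (induction f) auto

text \<open>The indicator of \<open>C\<close> is the least valuation that makes all variables of
  \<open>C\<close> true, and satisfaction is monotone because formulas are negation-free. So this
  one valuation decides the entailment.\<close>

lemma implicant_iff_sat: "implicant f C \<longleftrightarrow> sat (\<lambda>x. x \<in> C) f"
proof
  assume "sat (\<lambda>x. x \<in> C) f"
  then show "implicant f C"
    using sat_mono[of "\<lambda>x. x \<in> C" f] by (simp add: implicant_def entails_def)
qed (simp add: implicant_def entails_def)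

lemma implicant_mono: "implicant f C \<Longrightarrow> C \<subseteq> D \<Longrightarrow> implicant f D"
  by (auto simp: implicant_def entails_def)

lemma prime_implicant_subset:
  assumes "finite C" "implicant f C"
  shows "\<exists>D\<subseteq>C. prime_implicant f D"
  using assms
proof (induction rule: finite_psubset_induct)
  case (psubset C)
  show ?case
  proof (cases "prime_implicant f C")
    case False
    then obtain D where "D \<subset> C" "implicant f D"
      using psubset.prems by (auto simp: prime_implicant_def)
    with psubset.IH show ?thesis by (meson order.trans psubset_imp_subset)
  qed blast
qed

lemma ex_causes_subset_iff:
  assumes "finite S"
  shows "(\<exists>C\<in>causes N t. C \<subseteq> S) \<longleftrightarrow> implicant (Phi N t) S"
proof
  assume "\<exists>C\<in>causes N t. C \<subseteq> S"
  then show "implicant (Phi N t) S"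
    by (auto simp: causes_def prime_implicant_def intro: implicant_mono)
next
  assume "implicant (Phi N t) S"
  from prime_implicant_subset[OF assms this] show "\<exists>C\<in>causes N t. C \<subseteq> S"
    by (auto simp: causes_def)
qed

text \<open>In a state, a marked persistent place holds \<infinity>, which firing preserves; a
  regular place outside the preset of \<open>t\<close> loses nothing.\<close>

lemma fire_keeps_token:
  assumes "is_state N b" "1 \<le> b s" "s \<in> per N \<or> s \<notin> preset N t" "reg N \<inter> per N = {}"
  shows "1 \<le> fire N b t s"
proof -
  have "b s \<noteq> 0" using assms(2) by auto
  then have "s \<in> reg N \<union> per N" "s \<in> per N \<Longrightarrow> b s = \<infinity>"
    using assms(1) by (auto simp: is_state_def simp del: not_infinity_eq)
  then show ?thesis
    using assms(2-4) by (auto simp: fire_def intro: add_increasing2)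
qed

lemma firing_sequence_keeps_token:
  assumes "firing_sequence N b \<sigma> b'" "p_net N" "is_state N b" "1 \<le> b s"
    and "s \<in> per N \<or> (\<forall>u\<in>set \<sigma>. s \<notin> preset N u)"
  shows "1 \<le> b' s"
  using assms
proof (induction rule: firing_sequence.induct)
  case (Cons b t ts b')
  have "1 \<le> fire N b t s"
    by (rule fire_keeps_token) (use Cons.prems in \<open>auto simp: p_net_def\<close>)
  then show ?case
    using Cons.IH Cons.prems by (auto intro: is_state_fire)
qed

text \<open>The token is there once \<open>u\<close> has fired; from then on
  \<open>firing_sequence_keeps_token\<close> applies, as the place is persistent or has no consumer
  in the sequence.\<close>

lemma firing_sequence_produces_token:
  assumes "firing_sequence N b \<sigma> b'" "p_net N" "is_state N b"
    and "u \<in> set \<sigma>" "u \<in> preset N s" "s \<in> reg N \<union> per N"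
    and "s \<in> per N \<or> (\<forall>u\<in>set \<sigma>. s \<notin> preset N u)"
  shows "1 \<le> b' s"
  using assms
proof (induction rule: firing_sequence.induct)
  case (Cons b t ts b')
  show ?case
  proof (cases "u = t")
    case True
    then have "1 \<le> fire N b t s"
      using Cons.prems by (auto simp: fire_def postset_def preset_def)
    then show ?thesis
      using firing_sequence_keeps_token[OF Cons.hyps(2)] Cons.prems by (auto intro: is_state_fire)
  next
    case False
    then show ?thesis using Cons by (auto intro: is_state_fire)
  qed
qed simp

text \<open>\<open>A\<close> stands for the transitions fired earlier. It is arbitrary in the
  induction because each step moves the first transition of the sequence into
  \<open>A\<close>.\<close>

lemma marked_place_sat_Phi:
  assumes "firing_sequence N b \<sigma> b'" "p_net N" "wf (flow N)"
    and "\<And>s. 1 \<le> b s \<Longrightarrow> sat (\<lambda>x. x \<in> A) (Phi N s)"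
    and "1 \<le> b' s"
  shows "sat (\<lambda>x. x \<in> A \<union> set \<sigma>) (Phi N s)"
  using assms
proof (induction arbitrary: A rule: firing_sequence.induct)
  case (Cons b t ts b')
  have t: "t \<in> trn N" "\<forall>s\<in>preset N t. 1 \<le> b s"
    using Cons.hyps(1) by (auto simp: enabled_def)
  \<comment> \<open>Needed for the places that \<open>t\<close> fills: their formula has the
    disjunct \<open>And (Var t) (Phi N t)\<close>.\<close>
  have sat_t: "sat (\<lambda>x. x \<in> insert t A) (Phi N t)"
  proof (rule sat_mono)
    show "sat (\<lambda>x. x \<in> A) (Phi N t)"
      using t(2) Cons.prems(3) by (simp add: Phi_transition[OF Cons.prems(2) t(1)])
  qed simp
  have "sat (\<lambda>x. x \<in> insert t A) (Phi N s)" if "1 \<le> fire N b t s" for s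
  proof (cases "t \<in> preset N s")
    case True
    have "s \<notin> trn N" "preset N s \<noteq> {}"
      using True t(1) Cons.prems(1) by (auto simp: p_net_def preset_def)
    then show ?thesis
      using True sat_t by (auto simp: Phi_place[OF Cons.prems(2)])
  next
    case False
    \<comment> \<open>Here \<open>t\<close> does not produce into \<open>s\<close>, and truncated
      subtraction leaves 0 at 0, so firing cannot mark \<open>s\<close> if it was unmarked.\<close>
    have "b s \<noteq> 0"
    proof
      assume "b s = 0"
      with that False show False
        by (auto simp: fire_def postset_def preset_def split: if_splits)
    qed
    then have "1 \<le> b s" by (simp add: ileI1 one_eSuc)
    from sat_mono[OF Cons.prems(3)[OF this]] show ?thesis by simp
  qed
  then have "sat (\<lambda>x. x \<in> insert t A \<union> set ts) (Phi N s)"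
    using Cons.IH Cons.prems by blast
  then show ?case by simp
qed simp

lemma initial_sat_Phi:
  assumes "p_net N" "wf (flow N)" "1 \<le> initial N s"
  shows "sat v (Phi N s)"
proof -
  have "s \<notin> trn N" "preset N s = {}"
    using assms(1,3) by (auto simp: initial_def p_net_def split: if_splits)
  then show ?thesis by (simp add: Phi_place_initial[OF assms(2)])
qed

lemma occurrence_p_net_consumer_unique:
  assumes "occurrence_p_net N" "s \<in> reg N" "s \<in> preset N t" "s \<in> preset N u"
  shows "u = t"
proof -
  have "finite (postset N s)" "card (postset N s) \<le> Suc 0"
    using assms(1,2) by (auto simp: occurrence_p_net_def)
  then show ?thesis
    using assms(3,4) by (auto simp: card_le_Suc0_iff_eq preset_def postset_def)
qed

text \<open>\<open>Phi N t\<close> is the conjunction of the formulas of the places in the preset of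
  \<open>t\<close>, so the equivalence can be checked place by place.\<close>

lemma enabled_iff_implicant:
  assumes N: "occurrence_p_net N" and wf: "wf (flow N)"
    and fs: "firing_sequence N (initial N) \<sigma> b"
    and t: "t \<in> trn N" "t \<notin> set \<sigma>"
  shows "enabled N b t \<longleftrightarrow> implicant (Phi N t) (set \<sigma>)"
proof -
  have p: "p_net N" using N by (simp add: occurrence_p_net_def)
  have "1 \<le> b s \<longleftrightarrow> sat (\<lambda>x. x \<in> set \<sigma>) (Phi N s)" if s: "s \<in> preset N t" for s
  proof
    assume "1 \<le> b s"
    then show "sat (\<lambda>x. x \<in> set \<sigma>) (Phi N s)"
      \<comment> \<open>Before \<open>\<sigma>\<close> nothing has fired, hence the empty set for
        \<open>A\<close>.\<close>
      using marked_place_sat_Phi[OF fs p wf, of "{}"] initial_sat_Phi[OF p wf] by simp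
  next
    assume sat: "sat (\<lambda>x. x \<in> set \<sigma>) (Phi N s)"
    have s_place: "s \<in> reg N \<union> per N" "s \<notin> trn N"
      using s t(1) p by (auto simp: p_net_def preset_def)
    \<comment> \<open>If \<open>s\<close> is regular, a consumer of \<open>s\<close> in
      \<open>\<sigma>\<close> would have to be \<open>t\<close>, which has not fired.\<close>
    have unconsumed: "s \<in> per N \<or> (\<forall>u\<in>set \<sigma>. s \<notin> preset N u)"
      using occurrence_p_net_consumer_unique[OF N _ s] s_place(1) t(2) by blast
    show "1 \<le> b s"
    proof (cases "preset N s = {}")
      case True
      then have "1 \<le> initial N s" using s_place(1) by (auto simp: initial_def)
      then show ?thesis
        using firing_sequence_keeps_token[OF fs p is_state_initial[OF p]] unconsumed by blast
    next
      case False
      \<comment> \<open>A satisfied disjunct of \<open>Phi N s\<close> supplies a producer of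
        \<open>s\<close> occurring in \<open>\<sigma>\<close>.\<close>
      then obtain u where "u \<in> set \<sigma>" "u \<in> preset N s"
        using sat s_place(2) by (auto simp: Phi_place[OF wf])
      then show ?thesis
        using firing_sequence_produces_token[OF fs p is_state_initial[OF p]] s_place(1) unconsumed
        by blast
    qed
  qed
  then show ?thesis
    using t(1) by (simp add: enabled_def implicant_iff_sat Phi_transition[OF wf])
qed

theorem theorem5p3:
  fixes N :: "'a net" and \<sigma> :: "'a list" and t :: 'a and b :: "'a \<Rightarrow> enat"
  assumes "occurrence_p_net N"
    and "wf (flow N)"
    and "firing_sequence N (initial N) \<sigma> b"
    and "distinct \<sigma>"
    and "t \<in> trn N"
    and "t \<notin> set \<sigma>"
  shows "(enabled N b t \<longleftrightarrow> (\<exists>C\<in>causes N t. C \<subseteq> set \<sigma>)) \<and>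
         ((\<exists>C\<in>causes N t. C \<subseteq> set \<sigma>) \<longleftrightarrow> entails (BigAnd (set \<sigma>) Var) (Phi N t))"
  using enabled_iff_implicant[OF assms(1-3,5,6)] ex_causes_subset_iff[of "set \<sigma>" N t]
  by (simp add: implicant_def)

end
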